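(* Let $r$ and $s$ be relatively prime positive integers. For $\ell \in \{0,1,2,\ldots,s-1\}$, let \[ u_{\ell} = \left[\frac{r\ell}{s}\right] \] and \[ h^{(\ell)}_{r/s}(x,y) = \frac{r(x-\ell)(x-\ell-s)}{2s^2} + \frac{(u_{\ell}+1)(x-\ell)}{s} + y . \] Then the function $H_{r/s}$ defined by \[ H_{r/s}(x,y) = s\,h^{(\ell)}_{r/s}(x,y) + \ell \qquad \text{if } x \equiv \ell \pmod{s} \] is a quasi-polynomial packing function with period $s$ on the integer sector $I(r/s) = \{(x,y)\in\mathbf{N}_0^2 : 0 \le y \le rx/s\}$; that is, $H_{r/s}$ is a quasi-polynomial with period $s$ and it restricts to a bijection from $I(r/s)$ onto $\mathbf{N}_0$.
   Context: $\mathbf{N}_0$ denotes the set of nonnegative integers, and $[t]$ denotes the integer part (floor) of the real number $t$. A packing function on an integer sector $I\subseteq \mathbf{N}_0^2$ is a one-to-one correspondence between $I$ and $\mathbf{N}_0$. A function $H$ whose domain is a set of lattice points in $\mathbf{Z}^2$ is a quasi-polynomial with period $m$ if $H(x,y) = \sum_{i=0}^{d_1}\sum_{j=0}^{d_2} c_{i,j}(x,y)x^iy^j$, where the value of each $c_{i,j}(x,y)$ (not necessarily an integer) depends only on the congruence classes of $x$ and $y$ modulo $m$. *)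

theory Defs
  imports Complex_Main "HOL-Number_Theory.Cong"
begin

text \<open>
  Lattice points are pairs of integers. The coefficients are indexed by all of the
  integer plane; only their values on the domain \<open>D\<close> matter.
\<close>

definition quasi_polynomial_on :: "(int \<times> int) set \<Rightarrow> nat \<Rightarrow> (int \<Rightarrow> int \<Rightarrow> real) \<Rightarrow> bool" where
  "quasi_polynomial_on D m F \<longleftrightarrow> m > 0 \<and>
     (\<exists>(d1::nat) (d2::nat) (c :: nat \<Rightarrow> nat \<Rightarrow> int \<Rightarrow> int \<Rightarrow> real).
        (\<forall>i j x y x' y'. [x = x'] (mod int m) \<longrightarrow> [y = y'] (mod int m) \<longrightarrow>
            c i j x y = c i j x' y') \<and>
        (\<forall>(x, y)\<in>D. F x y =
            (\<Sum>i=0..d1. \<Sum>j=0..d2. c i j x y * real_of_int x ^ i * real_of_int y ^ j)))"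

definition integer_sector :: "real \<Rightarrow> (int \<times> int) set" where
  "integer_sector \<alpha> =
     {(x, y). 0 \<le> x \<and> 0 \<le> y \<and> real_of_int y \<le> \<alpha> * real_of_int x}"

text \<open>Here \<open>\<nat>\<close> is the set of nonnegative integers, as a subset of the reals.\<close>

definition packing_function_on :: "(int \<times> int) set \<Rightarrow> (int \<Rightarrow> int \<Rightarrow> real) \<Rightarrow> bool" where
  "packing_function_on I F \<longleftrightarrow> I \<subseteq> {0..} \<times> {0..} \<and> bij_betw (\<lambda>(x, y). F x y) I \<nat>"

definition u :: "nat \<Rightarrow> nat \<Rightarrow> nat \<Rightarrow> int" where
  "u r s l = \<lfloor>real r * real l / real s\<rfloor>"

definition h :: "nat \<Rightarrow> nat \<Rightarrow> nat \<Rightarrow> int \<Rightarrow> int \<Rightarrow> real" where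
  "h r s l x y =
     real r * (real_of_int x - real l) * (real_of_int x - real l - real s) / (2 * (real s)\<^sup>2)
     + (real_of_int (u r s l) + 1) * (real_of_int x - real l) / real s
     + real_of_int y"

text \<open>
  For \<open>s > 0\<close>, \<open>nat (x mod int s)\<close> is the unique \<open>l\<close> in \<open>{0..<s}\<close> congruent to \<open>x\<close> modulo \<open>s\<close>
  (also for negative \<open>x\<close>), so \<open>H r s\<close> is defined on the whole integer plane.
\<close>

definition H :: "nat \<Rightarrow> nat \<Rightarrow> int \<Rightarrow> int \<Rightarrow> real" where
  "H r s x y = (let l = nat (x mod int s) in real s * h r s l x y + real l)"

end

theory Submission
  imports Defs
begin

text \<open>
  On the column \<open>x = l + s k\<close> the sector consists of the points with
  \<open>0 \<le> y \<le> r k + u\<^sub>l\<close>, and \<open>h\<close> equals \<open>y\<close> plus the number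
  \<open>(\<Sum>j<k. r j + u\<^sub>l + 1)\<close> of points on the earlier columns of the same residue class. Hence
  \<open>h\<close> enumerates this class column by column, and \<open>s h + l\<close> enumerates the numbers
  congruent to \<open>l\<close> modulo \<open>s\<close>.
\<close>

text \<open>This locates the column holding the point numbered \<open>n\<close> of a residue class:
  \<open>k\<close> is the predecessor of the least index at which \<open>T\<close> exceeds
  \<open>n\<close>. Such an index exists because \<open>n < T (Suc n)\<close>.\<close>

lemma strict_mono_interval_exists:
  fixes T :: "nat \<Rightarrow> nat"
  assumes "strict_mono T" and "T 0 = 0"
  obtains k where "T k \<le> n" and "n < T (Suc k)"
proof -
  have "n < T (Suc n)"
    using strict_mono_imp_increasing[OF assms(1), of "Suc n"] by simp
  moreover have "\<not> n < T 0" using assms(2) by simp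
  ultimately obtain k where "\<not> n < T k" "n < T (Suc k)"
    using ex_least_nat_less[of "\<lambda>k. n < T k" "Suc n"] by blast
  then show thesis using that[of k] by simp
qed

lemma strict_mono_interval_unique:
  fixes T :: "nat \<Rightarrow> nat"
  assumes "strict_mono T"
    and "T k \<le> n" "n < T (Suc k)" "T k' \<le> n" "n < T (Suc k')"
  shows "k = k'"
proof -
  have "T k < T (Suc k')" "T k' < T (Suc k)" using assms by linarith+
  then show ?thesis
    using strict_mono_less[OF assms(1)] by (metis less_Suc_eq_le order_antisym)
qed

text \<open>The parameter \<open>a\<close> will be \<open>r * l div s\<close>. The
  \<open>+ 1\<close> counts the point with \<open>y = 0\<close>, so each column is nonempty and the
  offsets increase strictly.\<close>

definition column_offset :: "nat \<Rightarrow> nat \<Rightarrow> nat \<Rightarrow> nat" where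
  "column_offset r a k = (\<Sum>j<k. r * j + a + 1)"

lemma column_offset_0: "column_offset r a 0 = 0"
  by (simp add: column_offset_def)

lemma column_offset_Suc: "column_offset r a (Suc k) = column_offset r a k + (r * k + a + 1)"
  by (simp add: column_offset_def)

lemma strict_mono_column_offset: "strict_mono (column_offset r a)"
  by (simp add: strict_mono_Suc_iff column_offset_Suc)

text \<open>At \<open>x = l + s * k\<close> the powers of \<open>s\<close> in
  \<open>h r s l x y\<close> cancel, which leaves this closed form plus \<open>y\<close>.\<close>

lemma real_column_offset:
  "real (column_offset r a k) = real r * real k * (real k - 1) / 2 + (real a + 1) * real k"
  by (induction k) (simp_all add: column_offset_0 column_offset_Suc field_simps)

lemma u_eq_div: "u r s l = int (r * l div s)"
  unfolding u_def by (metis floor_divide_of_nat_eq of_nat_mult)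

text \<open>This exhibits \<open>H\<close> as a natural number already divided by \<open>s\<close>:
  the remainder is the residue class, the quotient the position within it.\<close>

lemma H_column:
  assumes "l < s"
  shows "H r s (int (l + s * k)) (int y) =
    real (s * (column_offset r (r * l div s) k + y) + l)"
proof -
  have "nat (int (l + s * k) mod int s) = l"
    using assms by (metis mod_less mod_mult_self2 nat_int zmod_int)
  moreover have "h r s l (int (l + s * k)) (int y) =
    real (column_offset r (r * l div s) k + y)"
    using assms by (simp add: h_def u_eq_div real_column_offset field_simps power2_eq_square)
  ultimately show ?thesis
    by (simp add: H_def)
qed

lemma column_mem_integer_sector_iff:
  assumes "s > 0"
  shows "(int (l + s * k), int y) \<in> integer_sector (real r / real s) \<longleftrightarrow>
    y \<le> r * k + r * l div s"
proof -
  have "(int (l + s * k), int y) \<in> integer_sector (real r / real s) \<longleftrightarrow>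
      real (y * s) \<le> real (r * (l + s * k))"
    using assms by (simp add: integer_sector_def field_simps)
  \<comment> \<open>An integer lies below a fraction iff it lies below its floor; the multiple
    \<open>r * k * s\<close> then leaves the division as \<open>r * k\<close>.\<close>
  also have "\<dots> \<longleftrightarrow> y \<le> (r * l + r * k * s) div s"
    unfolding of_nat_le_iff using assms
    by (simp add: less_eq_div_iff_mult_less_eq algebra_simps)
  also have "\<dots> \<longleftrightarrow> y \<le> r * k + r * l div s"
    using assms by simp
  finally show ?thesis .
qed

lemma integer_sector_columnE:
  assumes "s > 0" and "(x, y) \<in> integer_sector (real r / real s)"
  obtains l k m where "l < s" "x = int (l + s * k)" "y = int m" "m \<le> r * k + r * l div s"
proof -
  have "0 \<le> x" "0 \<le> y" using assms(2) by (auto simp: integer_sector_def)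
  then obtain n m where nm: "x = int n" "y = int m" by (metis nonneg_int_cases)
  have "x = int (n mod s + s * (n div s))" using nm by simp
  moreover from this have "m \<le> r * (n div s) + r * (n mod s) div s"
    using assms nm(2) column_mem_integer_sector_iff by metis
  ultimately show thesis
    using that[of "n mod s" "n div s" m] assms(1) nm(2) by simp
qed

lemma H_bij_betw:
  assumes "s > 0"
  shows "bij_betw (\<lambda>(x, y). H r s x y) (integer_sector (real r / real s)) \<nat>"
proof (rule bij_betwI')
  fix p q
  assume "p \<in> integer_sector (real r / real s)" "q \<in> integer_sector (real r / real s)"
  then obtain l k m l' k' m' where
    p: "l < s" "p = (int (l + s * k), int m)" "m \<le> r * k + r * l div s" and
    q: "l' < s" "q = (int (l' + s * k'), int m')" "m' \<le> r * k' + r * l' div s"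
    using assms by (metis integer_sector_columnE surj_pair)
  define T where "T l = column_offset r (r * l div s)" for l
  show "((case p of (x, y) \<Rightarrow> H r s x y) = (case q of (x, y) \<Rightarrow> H r s x y)) = (p = q)"
  proof
    assume "(case p of (x, y) \<Rightarrow> H r s x y) = (case q of (x, y) \<Rightarrow> H r s x y)"
    then have eq: "s * (T l k + m) + l = s * (T l' k' + m') + l'"
      unfolding p(2) q(2) prod.case H_column[OF p(1)] H_column[OF q(1)] of_nat_eq_iff T_def .
    \<comment> \<open>Reduction modulo \<open>s\<close> recovers the residue class.\<close>
    have l: "l = l'"
      using arg_cong[OF eq, of "\<lambda>n. n mod s"] p(1) q(1) by simp
    with eq assms have e: "T l k + m = T l k' + m'" by simp
    \<comment> \<open>The bounds on \<open>m\<close> and \<open>m'\<close> put the common value into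
      the interval from \<open>T l k\<close> to \<open>T l (Suc k)\<close>, and likewise for
      \<open>k'\<close>.\<close>
    have "k = k'"
      by (rule strict_mono_interval_unique[of "T l" k "T l k + m" k'])
        (use p(3) q(3) e l in \<open>auto simp: T_def strict_mono_column_offset column_offset_Suc\<close>)
    with e l p(2) q(2) show "p = q" by simp
  qed simp
next
  fix p assume "p \<in> integer_sector (real r / real s)"
  then obtain l k m where "l < s" "p = (int (l + s * k), int m)"
    using assms by (metis integer_sector_columnE surj_pair)
  then show "(case p of (x, y) \<Rightarrow> H r s x y) \<in> \<nat>"
    by (simp only: prod.case H_column of_nat_in_Nats)
next
  fix z :: real assume "z \<in> \<nat>"
  then obtain n where n: "z = real n" by (elim Nats_cases)
  \<comment> \<open>The preimage is read off from \<open>n\<close>: the remainder gives the class,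
    the interval containing \<open>n div s\<close> gives the column, and the excess over the offset
    gives the height.\<close>
  define l where "l = n mod s"
  let ?T = "column_offset r (r * l div s)"
  obtain k where k: "?T k \<le> n div s" "n div s < ?T (Suc k)"
    by (rule strict_mono_interval_exists[OF strict_mono_column_offset column_offset_0])
  define y where "y = n div s - ?T k"
  have "l < s" using assms by (simp add: l_def)
  then have "H r s (int (l + s * k)) (int y) = z"
    using k(1) by (simp only: H_column y_def n le_add_diff_inverse of_nat_eq_iff)
      (simp add: l_def)
  moreover have "(int (l + s * k), int y) \<in> integer_sector (real r / real s)"
    unfolding column_mem_integer_sector_iff[OF assms]
    using k by (simp add: y_def column_offset_Suc)
  ultimately show "\<exists>p\<in>integer_sector (real r / real s). z = (case p of (x, y) \<Rightarrow> H r s x y)"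
    by force
qed

lemma H_quasi_polynomial:
  assumes "s > 0"
  shows "quasi_polynomial_on UNIV s (H r s)"
proof -
  define L where "L x = real (nat (x mod int s))" for x :: int
  define V where "V x = real_of_int (u r s (nat (x mod int s))) + 1" for x :: int
  \<comment> \<open>These are the coefficients of \<open>s * h + l\<close> expanded in powers of
    \<open>x\<close> and \<open>y\<close>, with the periodic quantities \<open>L x\<close> and
    \<open>V x\<close> treated as constants.\<close>
  define c :: "nat \<Rightarrow> nat \<Rightarrow> int \<Rightarrow> int \<Rightarrow> real" where
    "c i j x y =
      (if i = 0 \<and> j = 0 then real r * L x * (L x + real s) / (2 * real s) - V x * L x + L x
       else if i = 1 \<and> j = 0 then V x - real r * (2 * L x + real s) / (2 * real s)
       else if i = 2 \<and> j = 0 then real r / (2 * real s)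
       else if i = 0 \<and> j = 1 then real s else 0)" for i j x y
  have "c i j x y = c i j x' y'" if "[x = x'] (mod int s)" for i j x y x' y'
    using that by (simp add: c_def L_def V_def cong_def)
  moreover have "H r s x y =
      (\<Sum>i=0..2. \<Sum>j=0..1. c i j x y * real_of_int x ^ i * real_of_int y ^ j)" for x y
  proof -
    have "H r s x y = real s * (real r * (real_of_int x - L x) * (real_of_int x - L x - real s) /
        (2 * (real s)\<^sup>2) + V x * (real_of_int x - L x) / real s + real_of_int y) + L x"
      by (simp add: H_def h_def L_def V_def Let_def)
    also have "\<dots> = c 0 0 x y + c 0 1 x y * real_of_int y + c 1 0 x y * real_of_int x
        + c 2 0 x y * (real_of_int x)\<^sup>2"
      using assms by (simp add: c_def field_simps power2_eq_square)
    also have "\<dots> = (\<Sum>i=0..2. \<Sum>j=0..1. c i j x y * real_of_int x ^ i * real_of_int y ^ j)"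
      by (simp add: numeral_2_eq_2 c_def)
    finally show ?thesis .
  qed
  ultimately show ?thesis
    using assms unfolding quasi_polynomial_on_def by blast
qed

theorem theorem12:
  fixes r s :: nat
  assumes "r > 0" and "s > 0" and "coprime r s"
  shows "quasi_polynomial_on UNIV s (H r s) \<and>
         packing_function_on (integer_sector (real r / real s)) (H r s)"
  using H_quasi_polynomial[OF assms(2)] H_bij_betw[OF assms(2)]
  by (auto simp: packing_function_on_def integer_sector_def)

end
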